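(* Let $0<\alpha<1$ and let $(U^n)_{0\le n\le N}$ be a solution of the fully discrete SFTR-$\frac12$ Crank–Nicolson scheme for the time-fractional Allen–Cahn equation with periodic boundary conditions, i.e. $U^n=\{U^n_{j,k}\}_{1\le j,k\le M}$ are real grid functions with $U^0_{j,k}=u_0(x_j,y_k)$ and, for all $1\le j,k\le M$ and $1\le n\le N$, $$\tau^{-\alpha}\sum_{m=0}^{n}\omega_m\,(U^{n-m}_{j,k}-U^0_{j,k})=\varepsilon^2(\Delta_h U^{n-\frac12})_{j,k}-f^{n-1,n}_{j,k}.$$ Define the discrete energy by $\mathcal{E}_h^0=E_h^0$ and, for $n\ge1$, $$\mathcal{E}_h^n=E_h^n+\frac{\tau^\alpha}{2}\sum_{s=1}^{n}\vartheta_{n-s}\,\|V^{s-\frac12}\|^2 .$$ Then $\mathcal{E}_h^n\le \mathcal{E}_h^{n-1}$ for all $n$ with $1\le n\le N$.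
   Context: Continuous problem being discretized: $\partial_t^\alpha u=\varepsilon^2\Delta u-(u^3-u)$ on $\Omega=(a,b)\times(a,b)$, $t\in(0,T]$, with periodic boundary conditions and initial datum $u_0$; $\partial_t^\alpha$ is the Caputo derivative of order $\alpha\in(0,1)$; $\varepsilon>0$ is a constant (thought of as small, $0<\varepsilon\ll1$). Mesh: $T>0$, $N$ a positive integer, $\tau=T/N$, $t_n=n\tau$; $M$ a positive integer, $h=(b-a)/M$, $x_k=y_k=a+kh$. Grid functions are real arrays $v=\{v_{j,k}\}_{1\le j,k\le M}$, extended periodically in both indices with period $M$. Inner product and norm: $(u,v)=h^2\sum_{1\le j,k\le M}u_{j,k}v_{j,k}$, $\|v\|^2=(v,v)$. Discrete Laplacian: $(\Delta_h v)_{j,k}=\frac{v_{j+1,k}-2v_{j,k}+v_{j-1,k}}{h^2}+\frac{v_{j,k+1}-2v_{j,k}+v_{j,k-1}}{h^2}$ (periodic indices). The discrete gradient $\nabla_h$ satisfies $(\nabla_h u,\nabla_h v)=(-\Delta_h u,v)$; in particular $\|\nabla_h v\|^2=(-\Delta_h v,v)$. Weights: $\omega_m$ ($m\ge0$) are the power series coefficients of $$\omega(\xi)=\sum_{m=0}^\infty\omega_m\xi^m=\left[\frac{1-\xi}{\frac12(1+\xi)+\frac1{2\alpha}(1-\xi)}\right]^\alpha,$$ and $\vartheta_m$ ($m\ge0$) are the power series coefficients of $1/\omega(\xi)$, i.e. $\sum_{m=0}^\infty\vartheta_m\xi^m=\frac{1}{\omega(\xi)}$ for $|\xi|<1$. Notation: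 $U^{n-\frac12}=\frac12(U^n+U^{n-1})$; $$f^{n-1,n}_{j,k}=\tfrac13(U^n_{j,k})^3+\tfrac12(U^{n-1}_{j,k})^2U^n_{j,k}+\tfrac16(U^{n-1}_{j,k})^3-\tfrac12(U^n_{j,k}+U^{n-1}_{j,k});$$ $V^{n-\frac12}=\varepsilon^2\Delta_hU^{n-\frac12}-f^{n-1,n}$ for $n\ge1$; $$E_h^n=\frac{\varepsilon^2}{2}\|\nabla_hU^n\|^2+\frac14\|(U^n)^{\circ2}-1\|^2,$$ where $(\cdot)^{\circ2}$ is the entrywise square and $1$ denotes the constant grid function. *)

theory Defs
  imports "HOL-Complex_Analysis.Complex_Analysis"
begin

section \<open>Periodic grid functions\<close>

text \<open>An array indexed by \<open>1 \<le> j, k \<le> M\<close> and extended with period \<open>M\<close> in both indices is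
  a doubly periodic function on pairs of integers.\<close>

type_synonym gridfun = "int \<Rightarrow> int \<Rightarrow> real"

definition periodic_grid :: "nat \<Rightarrow> gridfun \<Rightarrow> bool" where
  "periodic_grid M v \<longleftrightarrow> (\<forall>j k. v (j + int M) k = v j k \<and> v j (k + int M) = v j k)"

definition grid_inner :: "nat \<Rightarrow> real \<Rightarrow> gridfun \<Rightarrow> gridfun \<Rightarrow> real" where
  "grid_inner M h u v = h\<^sup>2 * (\<Sum>j\<in>{1..int M}. \<Sum>k\<in>{1..int M}. u j k * v j k)"

definition grid_norm :: "nat \<Rightarrow> real \<Rightarrow> gridfun \<Rightarrow> real" where
  "grid_norm M h v = sqrt (grid_inner M h v v)"

definition laplacian_h :: "real \<Rightarrow> gridfun \<Rightarrow> gridfun" where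
  "laplacian_h h v = (\<lambda>j k.
     (v (j + 1) k - 2 * v j k + v (j - 1) k) / h\<^sup>2 +
     (v j (k + 1) - 2 * v j k + v j (k - 1)) / h\<^sup>2)"

text \<open>The discrete gradient is taken with forward differences; lemma \<open>grad_inner_eq\<close> below is
  the relation to the discrete Laplacian that characterises it.\<close>

definition gradx_h :: "real \<Rightarrow> gridfun \<Rightarrow> gridfun" where
  "gradx_h h v = (\<lambda>j k. (v (j + 1) k - v j k) / h)"

definition grady_h :: "real \<Rightarrow> gridfun \<Rightarrow> gridfun" where
  "grady_h h v = (\<lambda>j k. (v j (k + 1) - v j k) / h)"

definition grad_inner :: "nat \<Rightarrow> real \<Rightarrow> gridfun \<Rightarrow> gridfun \<Rightarrow> real" where
  "grad_inner M h u v =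
     grid_inner M h (gradx_h h u) (gradx_h h v) + grid_inner M h (grady_h h u) (grady_h h v)"

definition grad_norm :: "nat \<Rightarrow> real \<Rightarrow> gridfun \<Rightarrow> real" where
  "grad_norm M h v = sqrt (grad_inner M h v v)"

lemma periodic_sum_shift:
  fixes g :: "int \<Rightarrow> real"
  assumes "\<And>j. g (j + int M) = g j"
  shows "(\<Sum>j\<in>{1..int M}. g (j - 1)) = (\<Sum>j\<in>{1..int M}. g j)"
proof (cases "M = 0")
  case False
  have "(\<Sum>j\<in>{1..int M}. g (j - 1)) = (\<Sum>j\<in>{0..int M - 1}. g j)"
    by (rule sum.reindex_bij_witness[of _ "\<lambda>j. j + 1" "\<lambda>j. j - 1"]) auto
  also have "{0..int M - 1} = insert 0 {1..int M - 1}" using False by auto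
  also have "(\<Sum>j\<in>insert 0 {1..int M - 1}. g j) = g (int M) + (\<Sum>j\<in>{1..int M - 1}. g j)"
    using assms[of 0] by simp
  also have "\<dots> = (\<Sum>j\<in>insert (int M) {1..int M - 1}. g j)" by simp
  also have "insert (int M) {1..int M - 1} = {1..int M}" using False by auto
  finally show ?thesis .
qed auto

lemma periodic_sum_by_parts:
  fixes p q :: "int \<Rightarrow> real"
  assumes "\<And>j. p (j + int M) = p j" and "\<And>j. q (j + int M) = q j"
  shows "(\<Sum>j\<in>{1..int M}. (p (j + 1) - p j) * (q (j + 1) - q j)) =
         (\<Sum>j\<in>{1..int M}. - (p (j + 1) - 2 * p j + p (j - 1)) * q j)"
proof -
  define g where "g = (\<lambda>j. (p (j + 1) - p j) * q (j + 1))"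
  have per: "g (j + int M) = g j" for j
    using assms(1)[of "j + 1"] assms(1)[of j] assms(2)[of "j + 1"]
    by (simp add: g_def add_ac)
  have "(\<Sum>j\<in>{1..int M}. (p (j + 1) - p j) * (q (j + 1) - q j)) =
        (\<Sum>j\<in>{1..int M}. g j) - (\<Sum>j\<in>{1..int M}. (p (j + 1) - p j) * q j)"
    by (simp add: g_def sum_subtractf[symmetric] algebra_simps)
  also have "(\<Sum>j\<in>{1..int M}. g j) = (\<Sum>j\<in>{1..int M}. g (j - 1))"
    using periodic_sum_shift[of g M] per by simp
  finally show ?thesis
    by (simp add: g_def sum_subtractf[symmetric] algebra_simps)
qed

lemma grad_inner_eq:
  assumes "periodic_grid M u" and "periodic_grid M v"
  shows "grad_inner M h u v = grid_inner M h (\<lambda>j k. - laplacian_h h u j k) v"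
proof -
  let ?I = "{1..int M}"
  have per: "u (j + int M) k = u j k" "u j (k + int M) = u j k"
            "v (j + int M) k = v j k" "v j (k + int M) = v j k" for j k
    using assms by (auto simp: periodic_grid_def)
  have x: "(\<Sum>j\<in>?I. \<Sum>k\<in>?I. gradx_h h u j k * gradx_h h v j k) =
        (\<Sum>j\<in>?I. \<Sum>k\<in>?I. - (u (j + 1) k - 2 * u j k + u (j - 1) k) * v j k / h\<^sup>2)"
  proof -
    have "(\<Sum>j\<in>?I. \<Sum>k\<in>?I. gradx_h h u j k * gradx_h h v j k) =
          (\<Sum>k\<in>?I. (\<Sum>j\<in>?I. (u (j + 1) k - u j k) * (v (j + 1) k - v j k)) / h\<^sup>2)"
      by (subst sum.swap) (simp add: gradx_h_def sum_divide_distrib power2_eq_square)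
    also have "\<dots> = (\<Sum>k\<in>?I. (\<Sum>j\<in>?I. - (u (j + 1) k - 2 * u j k + u (j - 1) k) * v j k) / h\<^sup>2)"
      by (intro sum.cong refl arg_cong2[where f = "(/)"] periodic_sum_by_parts per)
    also have "\<dots> = (\<Sum>j\<in>?I. \<Sum>k\<in>?I. - (u (j + 1) k - 2 * u j k + u (j - 1) k) * v j k / h\<^sup>2)"
      unfolding sum_divide_distrib by (rule sum.swap)
    finally show ?thesis .
  qed
  have y: "(\<Sum>j\<in>?I. \<Sum>k\<in>?I. grady_h h u j k * grady_h h v j k) =
        (\<Sum>j\<in>?I. \<Sum>k\<in>?I. - (u j (k + 1) - 2 * u j k + u j (k - 1)) * v j k / h\<^sup>2)"
  proof -
    have "(\<Sum>j\<in>?I. \<Sum>k\<in>?I. grady_h h u j k * grady_h h v j k) =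
          (\<Sum>j\<in>?I. (\<Sum>k\<in>?I. (u j (k + 1) - u j k) * (v j (k + 1) - v j k)) / h\<^sup>2)"
      by (simp add: grady_h_def sum_divide_distrib power2_eq_square)
    also have "\<dots> = (\<Sum>j\<in>?I. (\<Sum>k\<in>?I. - (u j (k + 1) - 2 * u j k + u j (k - 1)) * v j k) / h\<^sup>2)"
      by (intro sum.cong refl arg_cong2[where f = "(/)"] periodic_sum_by_parts per)
    finally show ?thesis unfolding sum_divide_distrib .
  qed
  show ?thesis
    unfolding grad_inner_def grid_inner_def x y laplacian_h_def
    by (simp only: distrib_left[symmetric] sum.distrib[symmetric])
       (intro arg_cong2[where f = "(*)"] refl sum.cong, simp add: divide_inverse algebra_simps)
qed

lemma grid_inner_self_nonneg: "grid_inner M h v v \<ge> 0"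
  unfolding grid_inner_def by (rule mult_nonneg_nonneg[OF zero_le_power2])
    (rule sum_nonneg, rule sum_nonneg, rule zero_le_square)

lemma grid_norm_squared: "(grid_norm M h v)\<^sup>2 = grid_inner M h v v"
  by (simp add: grid_norm_def grid_inner_self_nonneg)

lemma grad_norm_squared:
  assumes "periodic_grid M v"
  shows "(grad_norm M h v)\<^sup>2 = grid_inner M h (\<lambda>j k. - laplacian_h h v j k) v"
proof -
  have "grad_inner M h v v \<ge> 0" by (simp add: grad_inner_def grid_inner_self_nonneg)
  then show ?thesis by (simp add: grad_norm_def grad_inner_eq[OF assms assms])
qed

section \<open>Convolution weights\<close>

definition sftr_gen :: "real \<Rightarrow> real \<Rightarrow> real" where
  "sftr_gen \<alpha> \<xi> = ((1 - \<xi>) / (1/2 * (1 + \<xi>) + 1 / (2 * \<alpha>) * (1 - \<xi>))) powr \<alpha>"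

definition power_series_coeffs :: "(real \<Rightarrow> real) \<Rightarrow> nat \<Rightarrow> real" where
  "power_series_coeffs f = (THE c. \<forall>\<xi>. \<bar>\<xi>\<bar> < 1 \<longrightarrow> (\<lambda>m. c m * \<xi> ^ m) sums f \<xi>)"

definition sftr_omega :: "real \<Rightarrow> nat \<Rightarrow> real" where
  "sftr_omega \<alpha> = power_series_coeffs (sftr_gen \<alpha>)"

definition sftr_theta :: "real \<Rightarrow> nat \<Rightarrow> real" where
  "sftr_theta \<alpha> = power_series_coeffs (\<lambda>\<xi>. 1 / sftr_gen \<alpha> \<xi>)"

text \<open>Both definite descriptions are proper for \<open>0 < \<alpha> < 1\<close>: see \<open>sftr_omega_sums\<close> and
  \<open>sftr_theta_sums\<close>.\<close>

lemma power_series_coeffs_eqI: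
  assumes "\<And>\<xi>. \<bar>\<xi>\<bar> < 1 \<Longrightarrow> (\<lambda>m. c m * \<xi> ^ m) sums f \<xi>"
  shows "power_series_coeffs f = c"
  unfolding power_series_coeffs_def
proof (rule the_equality)
  show "\<forall>\<xi>. \<bar>\<xi>\<bar> < 1 \<longrightarrow> (\<lambda>m. c m * \<xi> ^ m) sums f \<xi>" using assms by blast
next
  fix d :: "nat \<Rightarrow> real"
  assume d: "\<forall>\<xi>. \<bar>\<xi>\<bar> < 1 \<longrightarrow> (\<lambda>m. d m * \<xi> ^ m) sums f \<xi>"
  have diff: "(\<lambda>m. (d m - c m) * (\<xi> - 0) ^ m) sums 0" if "norm (\<xi> - 0) < 1" for \<xi> :: real
    using sums_diff[of "\<lambda>m. d m * \<xi> ^ m" "f \<xi>" "\<lambda>m. c m * \<xi> ^ m" "f \<xi>"] d assms that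
    by (simp add: left_diff_distrib)
  have "d m - c m = 0" for m
  proof (rule ccontr)
    assume nz: "d m - c m \<noteq> 0"
    have "m > 0"
      using diff[of 0] nz powser_sums_zero_iff[of "\<lambda>m. d m - c m" 0] by (cases m) auto
    then obtain s :: real where "s > 0" and s: "\<And>z::real. z \<in> cball 0 s - {0} \<Longrightarrow> (0::real) \<noteq> 0"
      using powser_0_nonzero[of 1 0 "\<lambda>m. d m - c m" "\<lambda>_. 0" m] diff nz
      by (metis zero_less_one)
    show False using s[of s] \<open>s > 0\<close> by simp
  qed
  then show "d = c" by (simp add: fun_eq_iff)
qed

lemma power_series_coeffs_sums:
  fixes f :: "real \<Rightarrow> real" and F :: "complex \<Rightarrow> complex"
  assumes hol: "F holomorphic_on ball 0 1"
    and eq: "\<And>\<xi>. \<bar>\<xi>\<bar> < 1 \<Longrightarrow> F (of_real \<xi>) = of_real (f \<xi>)"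
    and "\<bar>\<xi>\<bar> < 1"
  shows "(\<lambda>m. power_series_coeffs f m * \<xi> ^ m) sums f \<xi>"
proof -
  define c where "c = (\<lambda>m. Re ((deriv ^^ m) F 0 / fact m))"
  have c: "(\<lambda>m. c m * x ^ m) sums f x" if "\<bar>x\<bar> < 1" for x
  proof -
    have "(\<lambda>m. (deriv ^^ m) F 0 / fact m * (of_real x - 0) ^ m) sums F (of_real x)"
      by (rule holomorphic_power_series[OF hol]) (use that in simp)
    then have "(\<lambda>m. Re ((deriv ^^ m) F 0 / fact m * of_real x ^ m)) sums f x"
      using eq[OF that] by (auto dest: sums_Re)
    moreover have "Re ((deriv ^^ m) F 0 / fact m * of_real x ^ m) = c m * x ^ m" for m
    proof -
      have "Re (w * of_real t) = Re w * t" for w t by simp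
      then show ?thesis unfolding c_def of_real_power[symmetric] .
    qed
    ultimately show ?thesis by simp
  qed
  have "power_series_coeffs f = c" by (rule power_series_coeffs_eqI) (rule c)
  then show ?thesis using c assms(3) by simp
qed

lemma sftr_base_notin_nonpos_Reals:
  fixes z :: complex and \<alpha> :: real
  assumes "0 < \<alpha>" "\<alpha> < 1" "norm z < 1"
  shows "1/2 * (1 + z) + of_real (1 / (2 * \<alpha>)) * (1 - z) \<noteq> 0"
    and "(1 - z) / (1/2 * (1 + z) + of_real (1 / (2 * \<alpha>)) * (1 - z)) \<notin> \<real>\<^sub>\<le>\<^sub>0"
proof -
  define d where "d = 1/2 * (1 + z) + of_real (1 / (2 * \<alpha>)) * (1 - z)"
  have "z \<noteq> 1" using assms by auto
  have key: "1 - z \<noteq> of_real r * d" if "r \<le> 0" for r :: real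
  proof
    assume e: "1 - z = of_real r * d"
    define A where "A = complex_of_real (1 / (2 * \<alpha>))"
    have "1 - z = of_real r * (1/2 * (1 + z) + A * (1 - z))"
      using e unfolding d_def A_def[symmetric] .
    also have "\<dots> = of_real r / 2 * (1 + z) + of_real r * A * (1 - z)"
      by (simp only: distrib_left mult.assoc times_divide_eq_left times_divide_eq_right mult_1_left mult_1_right)
    finally have "(1 - of_real r * A) * (1 - z) = of_real r / 2 * (1 + z)"
      unfolding left_diff_distrib[of 1 "of_real r * A"] mult_1_left diff_eq_eq .
    moreover have "of_real r * A = of_real (r / (2 * \<alpha>))" by (simp add: A_def)
    ultimately have "(1 - of_real (r / (2 * \<alpha>))) * (1 - z) = of_real (r / 2) * (1 + z)"
      by simp
    moreover have "of_real (1 - p - q) = z * of_real (1 - p + q)"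
      if "(1 - of_real p) * (1 - z) = of_real q * (1 + z)" for p q :: real
      using that by (simp add: algebra_simps)
    ultimately have "of_real (1 - r / (2 * \<alpha>) - r / 2) = z * of_real (1 - r / (2 * \<alpha>) + r / 2)"
      by blast
    then have "norm (of_real (1 - r / (2 * \<alpha>) - r / 2) :: complex) =
        norm (z * of_real (1 - r / (2 * \<alpha>) + r / 2))"
      by (rule arg_cong)
    then have eq: "\<bar>1 - r / (2 * \<alpha>) - r / 2\<bar> = norm z * \<bar>1 - r / (2 * \<alpha>) + r / 2\<bar>"
      unfolding norm_mult norm_of_real .
    have "1 / (2 * \<alpha>) \<ge> 1 / 2" using assms by (simp add: field_simps)
    then have "1 / (2 * \<alpha>) * r \<le> 1 / 2 * r" using that by (rule mult_right_mono_neg)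
    then have p: "r / (2 * \<alpha>) \<le> r / 2" by simp
    define x where "x = r / (2 * \<alpha>)"
    have le: "\<bar>1 - x + r / 2\<bar> \<le> \<bar>1 - x - r / 2\<bar>" and pos: "\<bar>1 - x - r / 2\<bar> > 0"
      using p that unfolding x_def[symmetric] by linarith+
    have "norm z * \<bar>1 - x + r / 2\<bar> \<le> norm z * \<bar>1 - x - r / 2\<bar>"
      using le by (intro mult_left_mono) auto
    also have "\<dots> < 1 * \<bar>1 - x - r / 2\<bar>"
      using pos assms(3) by (intro mult_strict_right_mono) auto
    finally show False using eq unfolding x_def[symmetric] by simp
  qed
  show d0: "1/2 * (1 + z) + of_real (1 / (2 * \<alpha>)) * (1 - z) \<noteq> 0"
  proof
    assume "1/2 * (1 + z) + of_real (1 / (2 * \<alpha>)) * (1 - z) = 0"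
    then have "2 * (z * of_real (1 - \<alpha>)) = 2 * of_real (1 + \<alpha>)"
      using assms by (simp add: field_simps)
    then have "z * of_real (1 - \<alpha>) = of_real (1 + \<alpha>)"
      unfolding mult_cancel_left by simp
    then have "norm (z * of_real (1 - \<alpha>)) = norm (of_real (1 + \<alpha>) :: complex)"
      by (rule arg_cong)
    then have "norm z * (1 - \<alpha>) = 1 + \<alpha>"
      unfolding norm_mult norm_of_real using assms by simp
    moreover have "norm z * (1 - \<alpha>) \<le> 1 * (1 - \<alpha>)" using assms by (intro mult_right_mono) auto
    ultimately show False using assms by simp
  qed
  show "(1 - z) / (1/2 * (1 + z) + of_real (1 / (2 * \<alpha>)) * (1 - z)) \<notin> \<real>\<^sub>\<le>\<^sub>0"
  proof
    assume "(1 - z) / (1/2 * (1 + z) + of_real (1 / (2 * \<alpha>)) * (1 - z)) \<in> \<real>\<^sub>\<le>\<^sub>0"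
    then obtain r where "r \<le> 0" "(1 - z) / d = of_real r"
      unfolding d_def by (auto elim: nonpos_Reals_cases)
    then show False using key[of r] d0 by (simp add: d_def divide_eq_eq)
  qed
qed

lemma sftr_base_pos:
  fixes \<xi> \<alpha> :: real
  assumes "0 < \<alpha>" "\<bar>\<xi>\<bar> < 1"
  shows "(1 - \<xi>) / (1/2 * (1 + \<xi>) + 1 / (2 * \<alpha>) * (1 - \<xi>)) > 0"
proof -
  have "1/2 * (1 + \<xi>) > 0" using assms by simp
  moreover have "1 / (2 * \<alpha>) * (1 - \<xi>) > 0" using assms by simp
  ultimately show ?thesis
    using assms(2) by (intro divide_pos_pos add_pos_pos) auto
qed

lemma sftr_gen_extension:
  fixes \<alpha> :: real
  assumes "0 < \<alpha>" "\<alpha> < 1"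
  defines "G \<equiv> (\<lambda>z::complex.
    ((1 - z) / (1/2 * (1 + z) + of_real (1 / (2 * \<alpha>)) * (1 - z))) powr of_real \<alpha>)"
  shows "G holomorphic_on ball 0 1"
    and "\<And>z. norm z < 1 \<Longrightarrow> G z \<noteq> 0"
    and "\<And>\<xi>. \<bar>\<xi>\<bar> < 1 \<Longrightarrow> G (of_real \<xi>) = of_real (sftr_gen \<alpha> \<xi>)"
proof -
  note nz = sftr_base_notin_nonpos_Reals[OF assms(1,2)]
  show "G holomorphic_on ball 0 1"
    unfolding G_def by (intro holomorphic_intros) (use nz in auto)
  show "G z \<noteq> 0" if "norm z < 1" for z
    using nz[OF that] that by (auto simp: G_def)
  show "G (of_real \<xi>) = of_real (sftr_gen \<alpha> \<xi>)" if "\<bar>\<xi>\<bar> < 1" for \<xi>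
  proof -
    define b where "b = (1 - \<xi>) / (1/2 * (1 + \<xi>) + 1 / (2 * \<alpha>) * (1 - \<xi>))"
    have "b > 0" unfolding b_def by (rule sftr_base_pos) (use that assms in auto)
    have "(1 - of_real \<xi>) / (1/2 * (1 + of_real \<xi>) + of_real (1 / (2 * \<alpha>)) * (1 - of_real \<xi>))
        = (of_real b :: complex)"
      by (simp add: b_def)
    then have "G (of_real \<xi>) = of_real b powr of_real \<alpha>" by (simp only: G_def)
    also have "\<dots> = of_real (b powr \<alpha>)"
      using \<open>b > 0\<close> by (simp add: powr_of_real)
    also have "b powr \<alpha> = sftr_gen \<alpha> \<xi>" by (simp only: b_def sftr_gen_def)
    finally show ?thesis .
  qed
qed

lemma sftr_omega_sums:
  assumes "0 < \<alpha>" "\<alpha> < 1" "\<bar>\<xi>\<bar> < 1"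
  shows "(\<lambda>m. sftr_omega \<alpha> m * \<xi> ^ m) sums sftr_gen \<alpha> \<xi>"
  unfolding sftr_omega_def
  by (rule power_series_coeffs_sums[OF sftr_gen_extension(1,3)]) (use assms in auto)

lemma sftr_theta_sums:
  assumes "0 < \<alpha>" "\<alpha> < 1" "\<bar>\<xi>\<bar> < 1"
  shows "(\<lambda>m. sftr_theta \<alpha> m * \<xi> ^ m) sums (1 / sftr_gen \<alpha> \<xi>)"
proof -
  define G where "G = (\<lambda>z::complex.
    ((1 - z) / (1/2 * (1 + z) + of_real (1 / (2 * \<alpha>)) * (1 - z))) powr of_real \<alpha>)"
  have ext: "G holomorphic_on ball 0 1" "\<And>z. norm z < 1 \<Longrightarrow> G z \<noteq> 0"
    "\<And>\<xi>. \<bar>\<xi>\<bar> < 1 \<Longrightarrow> G (of_real \<xi>) = of_real (sftr_gen \<alpha> \<xi>)"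
    unfolding G_def using sftr_gen_extension[OF assms(1,2)] by blast+
  show ?thesis unfolding sftr_theta_def
  proof (rule power_series_coeffs_sums[where F = "\<lambda>z. 1 / G z"])
    show "(\<lambda>z. 1 / G z) holomorphic_on ball 0 1"
      by (intro holomorphic_intros ext(1)) (use ext(2) in auto)
    show "1 / G (of_real x) = of_real (1 / sftr_gen \<alpha> x)" if "\<bar>x\<bar> < 1" for x
      using ext(3)[OF that] by simp
  qed (rule assms)
qed

section \<open>Scheme and discrete energies\<close>

text \<open>For \<open>midpoint_grid\<close>, \<open>cn_nonlin\<close> and \<open>cn_V\<close> the index \<open>n\<close> stands for time level
  \<open>n - 1/2\<close>; they are only used for \<open>n \<ge> 1\<close>, so the truncated \<open>n - 1\<close> is the true predecessor.\<close>

definition midpoint_grid :: "(nat \<Rightarrow> gridfun) \<Rightarrow> nat \<Rightarrow> gridfun" where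
  "midpoint_grid U n = (\<lambda>j k. (U n j k + U (n - 1) j k) / 2)"

definition cn_nonlin :: "(nat \<Rightarrow> gridfun) \<Rightarrow> nat \<Rightarrow> gridfun" where
  "cn_nonlin U n = (\<lambda>j k.
     1/3 * (U n j k) ^ 3 + 1/2 * (U (n - 1) j k)\<^sup>2 * U n j k
     + 1/6 * (U (n - 1) j k) ^ 3 - 1/2 * (U n j k + U (n - 1) j k))"

definition cn_V :: "real \<Rightarrow> real \<Rightarrow> (nat \<Rightarrow> gridfun) \<Rightarrow> nat \<Rightarrow> gridfun" where
  "cn_V \<epsilon> h U n = (\<lambda>j k. \<epsilon>\<^sup>2 * laplacian_h h (midpoint_grid U n) j k - cn_nonlin U n j k)"

definition sftr_cn_solution ::
  "real \<Rightarrow> real \<Rightarrow> nat \<Rightarrow> real \<Rightarrow> real \<Rightarrow> nat \<Rightarrow> real \<Rightarrow> (real \<Rightarrow> real \<Rightarrow> real) \<Rightarrow> (nat \<Rightarrow> gridfun) \<Rightarrow> bool"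
where
  "sftr_cn_solution \<alpha> \<epsilon> M a h N \<tau> u\<^sub>0 U \<longleftrightarrow>
     (\<forall>n\<le>N. periodic_grid M (U n)) \<and>
     (\<forall>j\<in>{1..int M}. \<forall>k\<in>{1..int M}.
        U 0 j k = u\<^sub>0 (a + of_int j * h) (a + of_int k * h)) \<and>
     (\<forall>n\<in>{1..N}. \<forall>j\<in>{1..int M}. \<forall>k\<in>{1..int M}.
        \<tau> powr (- \<alpha>) * (\<Sum>m=0..n. sftr_omega \<alpha> m * (U (n - m) j k - U 0 j k))
        = \<epsilon>\<^sup>2 * laplacian_h h (midpoint_grid U n) j k - cn_nonlin U n j k)"

definition energy_h :: "real \<Rightarrow> nat \<Rightarrow> real \<Rightarrow> gridfun \<Rightarrow> real" where
  "energy_h \<epsilon> M h v =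
     \<epsilon>\<^sup>2 / 2 * (grad_norm M h v)\<^sup>2 + 1/4 * (grid_norm M h (\<lambda>j k. (v j k)\<^sup>2 - 1))\<^sup>2"

definition modified_energy_h ::
  "real \<Rightarrow> real \<Rightarrow> nat \<Rightarrow> real \<Rightarrow> real \<Rightarrow> (nat \<Rightarrow> gridfun) \<Rightarrow> nat \<Rightarrow> real"
where
  "modified_energy_h \<alpha> \<epsilon> M h \<tau> U n =
     (if n = 0 then energy_h \<epsilon> M h (U 0)
      else energy_h \<epsilon> M h (U n)
        + \<tau> powr \<alpha> / 2 * (\<Sum>s=1..n. sftr_theta \<alpha> (n - s) * (grid_norm M h (cn_V \<epsilon> h U s))\<^sup>2))"

end

theory Submission
  imports Defs
begin

text \<open>Writing \<open>r = (1 - \<alpha>) / (1 + \<alpha>)\<close>, the weights \<open>\<vartheta>\<close> have the generating function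
  \<open>C ((1 - r\<xi>) / (1 - \<xi>)) powr \<alpha>\<close>. Its derivative, and minus the second derivative of its product
  with \<open>1 - \<xi>\<close>, are positive multiples of products of negative powers of \<open>1 - r\<xi>\<close> and \<open>1 - \<xi>\<close>;
  hence the weights are nonnegative and decreasing. Since \<open>\<vartheta>\<close> inverts \<open>\<omega>\<close>, the scheme reads
  \<open>U\<^sup>n - U\<^sup>0 = \<tau> powr \<alpha> * (\<Sum>s=1..n. \<vartheta>\<^bsub>n-s\<^esub> V\<^sup>s)\<close>, where \<open>V\<^sup>s\<close> is taken at time level \<open>s - 1/2\<close>. The energy
  difference is at most \<open>- (V\<^sup>n, U\<^sup>n - U\<^bsup>n-1\<^esup>)\<close>, and for a nonnegative decreasing kernel
  \<open>2 V\<^sup>s V\<^sup>n \<le> (V\<^sup>s)\<^sup>2 + (V\<^sup>n)\<^sup>2\<close> bounds this pointwise by the change of the memory term.\<close>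

section \<open>Power series\<close>

text \<open>Links formal products to products of functions on (-1, 1), so that the weights can be
  handled as formal power series.\<close>

lemma powser_mult_sums:
  fixes F G :: "real fps"
  assumes "\<And>x. \<bar>x\<bar> < 1 \<Longrightarrow> (\<lambda>m. fps_nth F m * x ^ m) sums f x"
    and "\<And>x. \<bar>x\<bar> < 1 \<Longrightarrow> (\<lambda>m. fps_nth G m * x ^ m) sums g x"
    and "\<bar>x\<bar> < 1"
  shows "(\<lambda>m. fps_nth (F * G) m * x ^ m) sums (f x * g x)"
proof -
  \<comment> \<open>Convergence at some \<open>y\<close> strictly beyond |x| gives absolute
    convergence at \<open>x\<close>, which the Cauchy product requires.\<close>
  obtain y where y: "\<bar>x\<bar> < y" "y < 1" using dense[OF assms(3)] by blast
  then have ay: "\<bar>y\<bar> < 1" "norm x < norm y" by auto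
  have sF: "summable (\<lambda>m. norm (fps_nth F m * x ^ m))"
    by (rule powser_insidea[OF sums_summable[OF assms(1)[OF ay(1)]] ay(2)])
  have sG: "summable (\<lambda>m. norm (fps_nth G m * x ^ m))"
    by (rule powser_insidea[OF sums_summable[OF assms(2)[OF ay(1)]] ay(2)])
  have "(\<lambda>k. \<Sum>i\<le>k. (fps_nth F i * x ^ i) * (fps_nth G (k - i) * x ^ (k - i))) sums
      ((\<Sum>k. fps_nth F k * x ^ k) * (\<Sum>k. fps_nth G k * x ^ k))"
    by (rule Cauchy_product_sums[OF sF sG])
  moreover have "(\<Sum>i\<le>k. (fps_nth F i * x ^ i) * (fps_nth G (k - i) * x ^ (k - i)))
      = fps_nth (F * G) k * x ^ k" for k
    unfolding fps_mult_nth sum_distrib_right atLeast0AtMost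
    by (intro sum.cong refl) (auto simp: power_add[symmetric])
  moreover have "(\<Sum>k. fps_nth F k * x ^ k) = f x" "(\<Sum>k. fps_nth G k * x ^ k) = g x"
    using assms(1)[OF assms(3)] assms(2)[OF assms(3)] by (simp_all add: sums_unique[symmetric])
  ultimately show ?thesis by simp
qed

text \<open>The binomial series of (1 - cX)^a. Exponents add under multiplication and
  differentiation lowers them by one, so real powers can be treated by ring algebra.\<close>

definition fps_binom_scaled :: "real \<Rightarrow> real \<Rightarrow> real fps" where
  "fps_binom_scaled c a = Abs_fps (\<lambda>n. (a gchoose n) * (- c) ^ n)"

lemma fps_binom_scaled_eq: "fps_binom_scaled c a = fps_compose (fps_binomial a) (fps_const (- c) * fps_X)"
  by (rule fps_ext) (simp add: fps_binom_scaled_def)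

lemma fps_binom_scaled_mult:
  "fps_binom_scaled c a * fps_binom_scaled c b = fps_binom_scaled c (a + b)"
  unfolding fps_binom_scaled_eq fps_binomial_add_mult
  by (rule fps_compose_mult_distrib[symmetric]) simp

lemma fps_binom_scaled_1: "fps_binom_scaled c 1 = 1 - fps_const c * fps_X"
proof (rule fps_ext)
  fix n
  have "(1::real) gchoose n = of_nat (1 choose n)" by (metis binomial_gbinomial of_nat_1)
  then show "fps_nth (fps_binom_scaled c 1) n = fps_nth (1 - fps_const c * fps_X) n"
    by (cases n; cases "n - 1") (auto simp: fps_binom_scaled_def)
qed

lemma fps_binom_scaled_deriv:
  "fps_deriv (fps_binom_scaled c a) = fps_const (- a * c) * fps_binom_scaled c (a - 1)"
proof (rule fps_ext)
  fix n
  have "real (Suc n) * (a gchoose Suc n) = a * ((a - 1) gchoose n)"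
    using gbinomial_absorption[of n a] by simp
  then have "real (Suc n) * (a gchoose Suc n) * (- c) ^ Suc n = a * ((a - 1) gchoose n) * (- c) ^ Suc n"
    by simp
  then show "fps_nth (fps_deriv (fps_binom_scaled c a)) n
      = fps_nth (fps_const (- a * c) * fps_binom_scaled c (a - 1)) n"
    by (simp add: fps_binom_scaled_def mult_ac)
qed

text \<open>For nonpositive \<open>a\<close> the sign (-1)^n of the binomial coefficient cancels
  that of (-c)^n.\<close>

lemma fps_binom_scaled_nonneg:
  assumes "0 \<le> c" "a \<le> 0"
  shows "fps_nth (fps_binom_scaled c a) n \<ge> 0"
proof -
  have "(- 1) ^ n * (- c) ^ n = c ^ n" by (simp flip: power_mult_distrib)
  then have "(a gchoose n) * (- c) ^ n = pochhammer (- a) n / fact n * c ^ n"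
    unfolding gbinomial_pochhammer by (simp add: mult_ac)
  moreover have "pochhammer (- a) n \<ge> 0"
    unfolding pochhammer_prod using assms by (intro prod_nonneg) auto
  ultimately show ?thesis using assms by (simp add: fps_binom_scaled_def)
qed

lemma fps_binom_scaled_sums:
  assumes "0 \<le> c" "c \<le> 1" "\<bar>x\<bar> < 1"
  shows "(\<lambda>m. fps_nth (fps_binom_scaled c a) m * x ^ m) sums ((1 - c * x) powr a)"
proof -
  have "\<bar>- c * x\<bar> \<le> 1 * \<bar>x\<bar>" unfolding abs_mult using assms by (intro mult_right_mono) auto
  then have "\<bar>- c * x\<bar> < 1" using assms by linarith
  from gen_binomial_real[OF this, of a] show ?thesis
    unfolding fps_binom_scaled_def power_mult_distrib by (simp add: mult.assoc)
qed

lemma fps_mult_nonneg: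
  fixes F G :: "real fps"
  assumes "\<And>n. fps_nth F n \<ge> 0" "\<And>n. fps_nth G n \<ge> 0"
  shows "fps_nth (F * G) n \<ge> 0"
  unfolding fps_mult_nth by (intro sum_nonneg mult_nonneg_nonneg assms)

section \<open>Sign and monotonicity of the weights\<close>

lemma fps_ratio_power_nonneg:
  fixes \<alpha> r :: real
  assumes "0 < \<alpha>" "\<alpha> < 1" "0 \<le> r" "r \<le> 1"
  shows "fps_nth (fps_binom_scaled r \<alpha> * fps_binom_scaled 1 (- \<alpha>)) n \<ge> 0"
proof (cases n)
  case 0
  then show ?thesis by (simp add: fps_binom_scaled_def)
next
  case (Suc k)
  define A where "A = fps_binom_scaled r (\<alpha> - 1)"
  define B where "B = fps_binom_scaled 1 (- \<alpha> - 1)"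
  have A: "fps_binom_scaled r \<alpha> = A * (1 - fps_const r * fps_X)"
    unfolding A_def fps_binom_scaled_1[symmetric] fps_binom_scaled_mult by simp
  have B: "fps_binom_scaled 1 (- \<alpha>) = B * (1 - fps_const 1 * fps_X)"
    unfolding B_def fps_binom_scaled_1[symmetric] fps_binom_scaled_mult by simp
  have dA: "fps_deriv (fps_binom_scaled r \<alpha>) = fps_const (- \<alpha> * r) * A"
    unfolding A_def by (rule fps_binom_scaled_deriv)
  have dB: "fps_deriv (fps_binom_scaled 1 (- \<alpha>)) = fps_const \<alpha> * B"
    unfolding B_def by (subst fps_binom_scaled_deriv) simp
  \<comment> \<open>Over the common factor \<open>A * B\<close> the product rule leaves \<alpha> (1
    - rX) - \<alpha> r (1 - X), which is the constant \<alpha> (1 - r).\<close>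
  have "fps_deriv (fps_binom_scaled r \<alpha> * fps_binom_scaled 1 (- \<alpha>))
      = fps_const (\<alpha> * (1 - r)) * (A * B)"
    unfolding fps_deriv_mult dA dB unfolding A B
    by (simp add: algebra_simps flip: fps_const_mult fps_const_sub fps_const_neg)
  then have "fps_nth (fps_deriv (fps_binom_scaled r \<alpha> * fps_binom_scaled 1 (- \<alpha>))) k
      = fps_nth (fps_const (\<alpha> * (1 - r)) * (A * B)) k"
    by (simp only:)
  then have "real (Suc k) * fps_nth (fps_binom_scaled r \<alpha> * fps_binom_scaled 1 (- \<alpha>)) (Suc k)
      = \<alpha> * (1 - r) * fps_nth (A * B) k"
    unfolding fps_deriv_nth fps_mult_left_const_nth Suc_eq_plus1 .
  moreover have "fps_nth (A * B) k \<ge> 0"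
    unfolding A_def B_def by (intro fps_mult_nonneg fps_binom_scaled_nonneg) (use assms in auto)
  ultimately have "real (Suc k) * fps_nth (fps_binom_scaled r \<alpha> * fps_binom_scaled 1 (- \<alpha>)) (Suc k) \<ge> 0"
    using assms by simp
  then show ?thesis unfolding Suc zero_le_mult_iff by simp
qed

text \<open>\<open>1 - rX\<close> and \<open>1 - X\<close> are affine, so their weighted geometric mean \<open>H\<close> has
  \<open>H''/H = - \<alpha> (1 - \<alpha>) (r / (1 - rX) - 1 / (1 - X))\<^sup>2\<close>, which makes \<open>H''\<close> minus a product
  of negative powers.\<close>

lemma fps_geometric_mean_nonpos:
  fixes \<alpha> r :: real
  assumes "0 < \<alpha>" "\<alpha> < 1" "0 \<le> r" "r \<le> 1"
  shows "fps_nth (fps_binom_scaled r \<alpha> * fps_binom_scaled 1 (1 - \<alpha>)) (Suc n) \<le> 0"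
proof (cases n)
  case 0
  \<comment> \<open>The second derivative sees only coefficients from index 2 on. Coefficient 1 is -
    \<alpha> r - (1 - \<alpha>).\<close>
  have "\<alpha> - \<alpha> * r \<le> 1" using mult_nonneg_nonneg[of \<alpha> r] assms by linarith
  then show ?thesis using 0 assms by (simp add: fps_binom_scaled_def fps_mult_nth algebra_simps)
next
  case (Suc k)
  define A where "A = fps_binom_scaled r (\<alpha> - 2)"
  define B where "B = fps_binom_scaled 1 (- 1 - \<alpha>)"
  \<comment> \<open>With the constants named as series, the identity for the second derivative
    becomes a pure ring identity.\<close>
  define a where "a = fps_const \<alpha>"
  define x where "x = fps_const r"
  define H where "H = fps_binom_scaled r \<alpha> * fps_binom_scaled 1 (1 - \<alpha>)"
  have A1: "fps_binom_scaled r (\<alpha> - 1) = A * (1 - x * fps_X)"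
    unfolding A_def x_def fps_binom_scaled_1[symmetric] fps_binom_scaled_mult by simp
  have A0: "fps_binom_scaled r \<alpha> = A * (1 - x * fps_X) * (1 - x * fps_X)"
    unfolding A1[symmetric] unfolding x_def fps_binom_scaled_1[symmetric] fps_binom_scaled_mult by simp
  have B1: "fps_binom_scaled 1 (- \<alpha>) = B * (1 - fps_X)"
    using fps_binom_scaled_mult[of 1 "- 1 - \<alpha>" 1] fps_binom_scaled_1[of 1] by (simp add: B_def)
  have B0: "fps_binom_scaled 1 (1 - \<alpha>) = B * (1 - fps_X) * (1 - fps_X)"
    using fps_binom_scaled_mult[of 1 "- \<alpha>" 1] fps_binom_scaled_1[of 1] B1 by simp
  have dA0: "fps_deriv (fps_binom_scaled r \<alpha>) = - a * x * fps_binom_scaled r (\<alpha> - 1)"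
    by (subst fps_binom_scaled_deriv) (simp add: a_def x_def)
  have dA1: "fps_deriv (fps_binom_scaled r (\<alpha> - 1)) = (1 - a) * x * A"
    by (subst fps_binom_scaled_deriv) (simp add: a_def x_def A_def flip: fps_const_sub fps_const_mult fps_const_1_eq_1)
  have dB0: "fps_deriv (fps_binom_scaled 1 (1 - \<alpha>)) = - (1 - a) * fps_binom_scaled 1 (- \<alpha>)"
    by (subst fps_binom_scaled_deriv) (simp add: a_def flip: fps_const_sub fps_const_mult fps_const_1_eq_1)
  have dB1: "fps_deriv (fps_binom_scaled 1 (- \<alpha>)) = a * B"
    by (subst fps_binom_scaled_deriv) (simp add: a_def B_def minus_diff_commute)
  have d0: "fps_deriv a = 0" "fps_deriv x = 0" by (auto simp: a_def x_def)
  \<comment> \<open>After factoring out - \<alpha> (1 - \<alpha>) A B, the product rule terms form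
    the square of (1 - rX) - r (1 - X) = 1 - r.\<close>
  have "fps_deriv (fps_deriv H) = - (a * (1 - a) * (1 - x) * (1 - x)) * (A * B)"
    unfolding H_def fps_deriv_mult fps_deriv_add fps_deriv_sub fps_deriv_neg dA0 dB0 dA1 dB1 d0 fps_deriv_1
    unfolding A0 B0 A1 B1 by (simp add: algebra_simps)
  also have "\<dots> = fps_const (- (\<alpha> * (1 - \<alpha>) * (1 - r) * (1 - r))) * (A * B)"
    by (simp add: a_def x_def flip: fps_const_sub fps_const_mult fps_const_1_eq_1 fps_const_neg)
  finally have "fps_nth (fps_deriv (fps_deriv H)) k
      = - (\<alpha> * (1 - \<alpha>) * (1 - r) * (1 - r)) * fps_nth (A * B) k"
    by (simp only: fps_mult_left_const_nth)
  moreover have "fps_nth (fps_deriv (fps_deriv H)) k = real (Suc k) * (real (Suc (Suc k)) * fps_nth H (Suc (Suc k)))"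
    unfolding fps_deriv_nth by simp
  moreover have "fps_nth (A * B) k \<ge> 0"
    unfolding A_def B_def by (intro fps_mult_nonneg fps_binom_scaled_nonneg) (use assms in auto)
  then have "- (\<alpha> * (1 - \<alpha>) * (1 - r) * (1 - r)) * fps_nth (A * B) k \<le> 0"
    using assms by simp
  ultimately have "real (Suc k) * (real (Suc (Suc k)) * fps_nth H (Suc (Suc k))) \<le> 0" by simp
  then show ?thesis unfolding Suc H_def mult_le_0_iff by simp
qed

section \<open>The weights \<vartheta>: closed form, sign, monotonicity and inverse\<close>

lemma sftr_theta_eq:
  fixes \<alpha> :: real
  assumes "0 < \<alpha>" "\<alpha> < 1"
  shows "sftr_theta \<alpha> = fps_nth (fps_const (((1 + \<alpha>) / (2 * \<alpha>)) powr \<alpha>) *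
    (fps_binom_scaled ((1 - \<alpha>) / (1 + \<alpha>)) \<alpha> * fps_binom_scaled 1 (- \<alpha>)))"
    (is "_ = fps_nth (fps_const ?K * (fps_binom_scaled ?r \<alpha> * _))")
  unfolding sftr_theta_def
proof (rule power_series_coeffs_eqI)
  fix x :: real assume x: "\<bar>x\<bar> < 1"
  have r: "0 \<le> ?r" "?r \<le> 1" using assms by auto
  have "(\<lambda>m. fps_nth (fps_binom_scaled ?r \<alpha> * fps_binom_scaled 1 (- \<alpha>)) m * x ^ m)
      sums ((1 - ?r * x) powr \<alpha> * (1 - 1 * x) powr (- \<alpha>))"
    by (rule powser_mult_sums[OF _ _ x]; rule fps_binom_scaled_sums) (use r in auto)
  from sums_mult[OF this, of ?K]
  have "(\<lambda>m. fps_nth (fps_const ?K * (fps_binom_scaled ?r \<alpha> * fps_binom_scaled 1 (- \<alpha>))) m * x ^ m)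
      sums (?K * ((1 - ?r * x) powr \<alpha> * (1 - x) powr (- \<alpha>)))"
    by (simp add: mult.assoc)
  also have "?K * ((1 - ?r * x) powr \<alpha> * (1 - x) powr (- \<alpha>)) = 1 / sftr_gen \<alpha> x"
  proof -
    \<comment> \<open>This denominator is affine in \<open>x\<close> and equals (1 + \<alpha>) / (2
      \<alpha>) times 1 - rx; hence the constant and the ratio in the closed form.\<close>
    define d where "d = 1/2 * (1 + x) + 1 / (2 * \<alpha>) * (1 - x)"
    have "(1 + \<alpha>) * (1 - ?r * x) = 1 + \<alpha> - (1 - \<alpha>) * x"
      using assms by (simp add: right_diff_distrib)
    moreover have "d = (1 + \<alpha> - (1 - \<alpha>) * x) / (2 * \<alpha>)"
      using assms by (simp add: d_def field_simps)
    ultimately have dd: "d = (1 + \<alpha>) / (2 * \<alpha>) * (1 - ?r * x)"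
      by (simp only: times_divide_eq_left)
    have "d powr \<alpha> = ?K * (1 - ?r * x) powr \<alpha>"
      unfolding dd by (rule powr_mult)
    moreover have "sftr_gen \<alpha> x = (1 - x) powr \<alpha> / d powr \<alpha>"
      unfolding sftr_gen_def d_def[symmetric] by (rule powr_divide)
    ultimately have "1 / sftr_gen \<alpha> x = ?K * (1 - ?r * x) powr \<alpha> / (1 - x) powr \<alpha>"
      by (simp only: divide_divide_eq_right mult_1_left)
    then show ?thesis by (simp only: powr_minus divide_inverse mult.assoc)
  qed
  finally show "(\<lambda>m. fps_nth (fps_const ?K * (fps_binom_scaled ?r \<alpha> * fps_binom_scaled 1 (- \<alpha>))) m * x ^ m)
      sums (1 / sftr_gen \<alpha> x)" .
qed

lemma sftr_theta_nonneg:
  assumes "0 < \<alpha>" "\<alpha> < 1"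
  shows "sftr_theta \<alpha> n \<ge> 0"
  unfolding sftr_theta_eq[OF assms] fps_mult_left_const_nth
  by (intro mult_nonneg_nonneg fps_ratio_power_nonneg) (use assms in auto)

text \<open>Multiplication by 1 - X takes backward differences of the coefficients and raises the
  exponent of 1 - X from - \<alpha> to 1 - \<alpha>, so the differences are coefficients of the
  geometric mean.\<close>

lemma sftr_theta_Suc_le:
  assumes "0 < \<alpha>" "\<alpha> < 1"
  shows "sftr_theta \<alpha> (Suc n) \<le> sftr_theta \<alpha> n"
proof -
  let ?P = "fps_binom_scaled ((1 - \<alpha>) / (1 + \<alpha>)) \<alpha> * fps_binom_scaled 1 (- \<alpha>)"
  have "fps_binom_scaled 1 (1 - \<alpha>) = fps_binom_scaled 1 (- \<alpha>) * (1 - fps_X)"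
    using fps_binom_scaled_mult[of 1 "- \<alpha>" 1] fps_binom_scaled_1[of 1] by simp
  then have "fps_binom_scaled ((1 - \<alpha>) / (1 + \<alpha>)) \<alpha> * fps_binom_scaled 1 (1 - \<alpha>) = ?P - fps_X * ?P"
    by (simp only:) (simp add: algebra_simps)
  then have "fps_nth (?P - fps_X * ?P) (Suc n) \<le> 0"
    using fps_geometric_mean_nonpos[of \<alpha> "(1 - \<alpha>) / (1 + \<alpha>)" n] assms by auto
  then have "fps_nth ?P (Suc n) \<le> fps_nth ?P n" by simp
  then show ?thesis
    unfolding sftr_theta_eq[OF assms] fps_mult_left_const_nth by (rule mult_left_mono) simp
qed

text \<open>The two generating functions multiply to 1 on (-1, 1), and the coefficients of the
  constant function 1 are unique.\<close>

lemma sftr_theta_omega: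
  assumes "0 < \<alpha>" "\<alpha> < 1"
  shows "Abs_fps (sftr_theta \<alpha>) * Abs_fps (sftr_omega \<alpha>) = 1"
proof -
  let ?P = "Abs_fps (sftr_theta \<alpha>) * Abs_fps (sftr_omega \<alpha>)"
  have "(\<lambda>m. fps_nth ?P m * x ^ m) sums 1" if x: "\<bar>x\<bar> < 1" for x
  proof -
    have "(\<lambda>m. fps_nth ?P m * x ^ m) sums (1 / sftr_gen \<alpha> x * sftr_gen \<alpha> x)"
      by (rule powser_mult_sums[OF _ _ x])
        (use sftr_theta_sums[OF assms] sftr_omega_sums[OF assms] in auto)
    moreover have "sftr_gen \<alpha> x \<noteq> 0"
      using sftr_base_pos[OF assms(1) x] unfolding sftr_gen_def powr_eq_0_iff
      by (rule less_imp_neq[THEN not_sym])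
    ultimately show ?thesis by simp
  qed
  then have "power_series_coeffs (\<lambda>_. 1) = fps_nth ?P" by (rule power_series_coeffs_eqI)
  moreover have "power_series_coeffs (\<lambda>_. 1) = fps_nth (1 :: real fps)"
  proof (rule power_series_coeffs_eqI)
    fix x :: real
    have "(\<lambda>m. fps_nth (1 :: real fps) m * x ^ m) = (\<lambda>m. if m = 0 then 1 else 0)" by auto
    then show "(\<lambda>m. fps_nth (1 :: real fps) m * x ^ m) sums 1"
      using sums_single[of 0 "\<lambda>_. 1 :: real"] by simp
  qed
  ultimately show ?thesis by (simp add: fps_nth_inject)
qed

section \<open>Energy decay\<close>

lemma sftr_inversion:
  fixes w v :: "nat \<Rightarrow> real"
  assumes "0 < \<alpha>" "\<alpha> < 1" "\<tau> > 0" "w 0 = 0"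
    and scheme: "\<And>n. 1 \<le> n \<Longrightarrow> n \<le> N \<Longrightarrow> \<tau> powr (- \<alpha>) * (\<Sum>m=0..n. sftr_omega \<alpha> m * w (n - m)) = v n"
    and "n \<le> N"
  shows "w n = \<tau> powr \<alpha> * (\<Sum>s=1..n. sftr_theta \<alpha> (n - s) * v s)"
proof -
  define W where "W = Abs_fps (sftr_omega \<alpha>) * Abs_fps w"
  have W: "fps_nth W s = \<tau> powr \<alpha> * v s" if "s \<in> {1..n}" for s
  proof -
    have "\<tau> powr (- \<alpha>) * fps_nth W s = v s"
      using scheme[of s] that assms(6) by (simp add: W_def fps_mult_nth)
    then show ?thesis using \<open>\<tau> > 0\<close> by (simp add: powr_minus field_simps)
  qed
  have "Abs_fps w = W * Abs_fps (sftr_theta \<alpha>)"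
    using sftr_theta_omega[OF assms(1,2)] by (simp add: W_def mult_ac)
  then have "fps_nth (Abs_fps w) n = fps_nth (W * Abs_fps (sftr_theta \<alpha>)) n" by (simp only:)
  then have "w n = (\<Sum>s=0..n. fps_nth W s * sftr_theta \<alpha> (n - s))"
    unfolding fps_mult_nth fps_nth_Abs_fps .
  \<comment> \<open>Coefficient 0 of \<open>W\<close> is a multiple of \<open>w 0\<close>, hence
    zero; the scheme itself starts only at level 1.\<close>
  also have "\<dots> = (\<Sum>s=1..n. fps_nth W s * sftr_theta \<alpha> (n - s))"
    using assms(4) by (simp add: sum.atLeast_Suc_atMost W_def)
  also have "\<dots> = (\<Sum>s=1..n. \<tau> powr \<alpha> * (sftr_theta \<alpha> (n - s) * v s))"
    by (intro sum.cong refl) (simp add: W)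
  finally show ?thesis by (simp add: sum_distrib_left)
qed

text \<open>With \<open>x\<close> and \<open>d\<close> as in the proof, twice the gap between the
  two sides is the sum of d_s (v_s - x)^2 plus \<theta>_m x^2, since the d_s add up to \<theta>_0 -
  \<theta>_m.\<close>

lemma sum_antitone_kernel_ge:
  fixes \<theta> v :: "nat \<Rightarrow> real"
  assumes nonneg: "\<And>n. \<theta> n \<ge> 0" and dec: "\<And>n. \<theta> (Suc n) \<le> \<theta> n"
  shows "v (Suc m) * ((\<Sum>s=1..Suc m. \<theta> (Suc m - s) * v s) - (\<Sum>s=1..m. \<theta> (m - s) * v s))
    \<ge> 1/2 * ((\<Sum>s=1..Suc m. \<theta> (Suc m - s) * (v s)\<^sup>2) - (\<Sum>s=1..m. \<theta> (m - s) * (v s)\<^sup>2))"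
proof -
  define x where "x = v (Suc m)"
  define d where "d = (\<lambda>s. \<theta> (m - s) - \<theta> (Suc m - s))"
  \<comment> \<open>One more time level puts weight \<open>\<theta> 0\<close> on the new entry and
    lowers the weight of each old one by \<open>d s\<close>.\<close>
  have split: "(\<Sum>s=1..Suc m. \<theta> (Suc m - s) * u s) - (\<Sum>s=1..m. \<theta> (m - s) * u s)
      = \<theta> 0 * u (Suc m) - (\<Sum>s=1..m. d s * u s)" for u :: "nat \<Rightarrow> real"
    by (simp add: d_def left_diff_distrib sum_subtractf)
  have sum_d: "(\<Sum>s=1..m. d s) = \<theta> 0 - \<theta> m"
  proof -
    have "(\<Sum>s=1..m. d s) = (\<Sum>i<m. \<theta> i - \<theta> (Suc i))"
      by (rule sum.reindex_bij_witness[of _ "\<lambda>i. m - i" "\<lambda>s. m - s"]) (auto simp: d_def Suc_diff_le)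
    then show ?thesis by (simp add: sum_lessThan_telescope')
  qed
  have "0 \<le> (\<Sum>s=1..m. d s * (v s - x)\<^sup>2)"
    using dec by (intro sum_nonneg mult_nonneg_nonneg) (auto simp: d_def Suc_diff_le)
  also have "\<dots> = (\<Sum>s=1..m. d s * (v s)\<^sup>2) - 2 * x * (\<Sum>s=1..m. d s * v s) + x\<^sup>2 * (\<Sum>s=1..m. d s)"
    unfolding sum_distrib_left sum_subtractf[symmetric] sum.distrib[symmetric]
    by (intro sum.cong refl) (simp add: power2_eq_square algebra_simps)
  also have "\<dots> \<le> (\<Sum>s=1..m. d s * (v s)\<^sup>2) - 2 * x * (\<Sum>s=1..m. d s * v s) + x\<^sup>2 * \<theta> 0"
    unfolding sum_d using nonneg[of m] by (simp add: mult_left_mono)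
  finally show ?thesis
    unfolding split x_def[symmetric] by (simp add: power2_eq_square right_diff_distrib mult_ac)
qed

section \<open>One-step differences of the discrete energy\<close>

lemma double_well_diff_le:
  fixes u v :: real
  shows "1/4 * (u\<^sup>2 - 1)\<^sup>2 - 1/4 * (v\<^sup>2 - 1)\<^sup>2
    \<le> (1/3 * u ^ 3 + 1/2 * v\<^sup>2 * u + 1/6 * v ^ 3 - 1/2 * (u + v)) * (u - v)"
proof -
  \<comment> \<open>The scheme's nonlinearity exceeds the difference quotient of the double well by
    exactly (u - v)^3 / 12; the factor u - v turns this into a fourth power.\<close>
  have "(1/3 * u ^ 3 + 1/2 * v\<^sup>2 * u + 1/6 * v ^ 3 - 1/2 * (u + v)) * (u - v)
      - (1/4 * (u\<^sup>2 - 1)\<^sup>2 - 1/4 * (v\<^sup>2 - 1)\<^sup>2) = 1/12 * ((u - v)\<^sup>2)\<^sup>2"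
    by (simp add: power2_eq_square power3_eq_cube field_simps)
  also have "\<dots> \<ge> 0" by simp
  finally show ?thesis unfolding diff_ge_0_iff_ge .
qed

text \<open>The identity p^2 - q^2 = 2 ((p + q) / 2) (p - q) for the linear difference operators,
  followed by summation by parts. The midpoint Laplacian is the one in \<open>cn_V\<close>.\<close>

lemma grad_norm_diff:
  assumes "periodic_grid M u" "periodic_grid M v"
  shows "(grad_norm M h u)\<^sup>2 - (grad_norm M h v)\<^sup>2
    = grid_inner M h (\<lambda>j k. - 2 * laplacian_h h (\<lambda>j k. (u j k + v j k) / 2) j k) (\<lambda>j k. u j k - v j k)"
proof -
  let ?m = "\<lambda>j k. (u j k + v j k) / 2" and ?d = "\<lambda>j k. u j k - v j k"
  have per: "periodic_grid M ?m" "periodic_grid M ?d"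
    using assms by (auto simp: periodic_grid_def)
  have eq: "grad_norm M h w ^ 2 = grad_inner M h w w" if "periodic_grid M w" for w
    using grad_norm_squared[OF that] grad_inner_eq[OF that that] by simp
  have x: "gradx_h h u j k * gradx_h h u j k - gradx_h h v j k * gradx_h h v j k
      = 2 * (gradx_h h ?m j k * gradx_h h ?d j k)" for j k
  proof -
    have "gradx_h h ?m j k = (gradx_h h u j k + gradx_h h v j k) / 2"
      by (simp add: gradx_h_def add_divide_distrib diff_divide_distrib)
    moreover have "gradx_h h ?d j k = gradx_h h u j k - gradx_h h v j k"
      by (simp add: gradx_h_def diff_divide_distrib)
    ultimately show ?thesis by (simp only:) (simp add: field_simps)
  qed
  have y: "grady_h h u j k * grady_h h u j k - grady_h h v j k * grady_h h v j k
      = 2 * (grady_h h ?m j k * grady_h h ?d j k)" for j k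
  proof -
    have "grady_h h ?m j k = (grady_h h u j k + grady_h h v j k) / 2"
      by (simp add: grady_h_def add_divide_distrib diff_divide_distrib)
    moreover have "grady_h h ?d j k = grady_h h u j k - grady_h h v j k"
      by (simp add: grady_h_def diff_divide_distrib)
    ultimately show ?thesis by (simp only:) (simp add: field_simps)
  qed
  have "grad_inner M h u u - grad_inner M h v v = 
     (grid_inner M h (gradx_h h u) (gradx_h h u) - grid_inner M h (gradx_h h v) (gradx_h h v))
     + (grid_inner M h (grady_h h u) (grady_h h u) - grid_inner M h (grady_h h v) (grady_h h v))"
    by (simp add: grad_inner_def)
  also have "\<dots> = 2 * grad_inner M h ?m ?d"
    unfolding grid_inner_def grad_inner_def right_diff_distrib[symmetric] sum_subtractf[symmetric] x y
    by (simp only: sum_distrib_left[symmetric] distrib_left mult.left_commute)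
  also have "\<dots> = grid_inner M h (\<lambda>j k. - 2 * laplacian_h h ?m j k) ?d"
    unfolding grad_inner_eq[OF per] grid_inner_def sum_distrib_left
    by (simp add: mult_ac)
  finally show ?thesis using assms by (simp add: eq)
qed

text \<open>The gradient part is exact, and the double well is estimated at each grid point. The
  bound stays a grid sum so that it can be compared pointwise with the memory term.\<close>

lemma energy_h_diff_le:
  assumes "periodic_grid M (U n)" "periodic_grid M (U (n - 1))"
  shows "energy_h \<epsilon> M h (U n) - energy_h \<epsilon> M h (U (n - 1))
    \<le> h\<^sup>2 * (\<Sum>j\<in>{1..int M}. \<Sum>k\<in>{1..int M}. - cn_V \<epsilon> h U n j k * (U n j k - U (n - 1) j k))"
proof -
  let ?I = "{1..int M}"
  let ?L = "\<lambda>j k. laplacian_h h (midpoint_grid U n) j k"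
  let ?W = "\<lambda>m j k. 1/4 * ((U m j k)\<^sup>2 - 1)\<^sup>2"
  have W: "1/4 * (grid_norm M h (\<lambda>j k. (U m j k)\<^sup>2 - 1))\<^sup>2 = h\<^sup>2 * (\<Sum>j\<in>?I. \<Sum>k\<in>?I. ?W m j k)" for m
    unfolding grid_norm_squared grid_inner_def
    by (simp add: sum_distrib_left mult_ac power2_eq_square)
  have G: "\<epsilon>\<^sup>2 / 2 * (grad_norm M h (U n))\<^sup>2 - \<epsilon>\<^sup>2 / 2 * (grad_norm M h (U (n - 1)))\<^sup>2
      = h\<^sup>2 * (\<Sum>j\<in>?I. \<Sum>k\<in>?I. - \<epsilon>\<^sup>2 * ?L j k * (U n j k - U (n - 1) j k))"
    unfolding right_diff_distrib[symmetric] grad_norm_diff[OF assms] grid_inner_def midpoint_grid_def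
    by (simp add: sum_distrib_left mult_ac)
  have "energy_h \<epsilon> M h (U n) - energy_h \<epsilon> M h (U (n - 1))
     = h\<^sup>2 * (\<Sum>j\<in>?I. \<Sum>k\<in>?I. - \<epsilon>\<^sup>2 * ?L j k * (U n j k - U (n - 1) j k))
     + (h\<^sup>2 * (\<Sum>j\<in>?I. \<Sum>k\<in>?I. ?W n j k) - h\<^sup>2 * (\<Sum>j\<in>?I. \<Sum>k\<in>?I. ?W (n - 1) j k))"
    unfolding energy_h_def W G[symmetric] by simp
  also have "\<dots> = h\<^sup>2 * (\<Sum>j\<in>?I. \<Sum>k\<in>?I. - \<epsilon>\<^sup>2 * ?L j k * (U n j k - U (n - 1) j k)
      + (?W n j k - ?W (n - 1) j k))"
    by (simp only: distrib_left right_diff_distrib sum.distrib sum_subtractf)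
  also have "\<dots> \<le> h\<^sup>2 * (\<Sum>j\<in>?I. \<Sum>k\<in>?I. - cn_V \<epsilon> h U n j k * (U n j k - U (n - 1) j k))"
  proof (intro mult_left_mono sum_mono)
    fix j k
    show "- \<epsilon>\<^sup>2 * ?L j k * (U n j k - U (n - 1) j k) + (?W n j k - ?W (n - 1) j k)
        \<le> - cn_V \<epsilon> h U n j k * (U n j k - U (n - 1) j k)"
      using double_well_diff_le[of "U n j k" "U (n - 1) j k"]
      unfolding cn_V_def cn_nonlin_def by (simp only: left_diff_distrib minus_diff_eq minus_mult_left[symmetric])
  qed simp
  finally show ?thesis .
qed

text \<open>Brings the memory term into the form of a grid sum of scalar time convolutions.\<close>

lemma sum_grid_norm_squared:
  "(\<Sum>s\<in>S. c s * (grid_norm M h (g s))\<^sup>2)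
    = h\<^sup>2 * (\<Sum>j\<in>{1..int M}. \<Sum>k\<in>{1..int M}. \<Sum>s\<in>S. c s * (g s j k)\<^sup>2)"
proof -
  let ?I = "{1..int M}"
  have "(\<Sum>j\<in>?I. \<Sum>k\<in>?I. \<Sum>s\<in>S. c s * (g s j k)\<^sup>2) = (\<Sum>j\<in>?I. \<Sum>s\<in>S. \<Sum>k\<in>?I. c s * (g s j k)\<^sup>2)"
    by (intro sum.cong refl sum.swap)
  also have "\<dots> = (\<Sum>s\<in>S. \<Sum>j\<in>?I. \<Sum>k\<in>?I. c s * (g s j k)\<^sup>2)" by (rule sum.swap)
  finally show ?thesis
    unfolding grid_norm_squared grid_inner_def
    by (simp add: sum_distrib_left mult_ac power2_eq_square)
qed

theorem theorem1:
  fixes \<alpha> \<epsilon> a b T h \<tau> :: real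
    and M N n :: nat
    and u\<^sub>0 :: "real \<Rightarrow> real \<Rightarrow> real"
    and U :: "nat \<Rightarrow> gridfun"
  assumes "0 < \<alpha>" and "\<alpha> < 1"
    and "\<epsilon> > 0"
    and "a < b" and "M \<ge> 1" and "h = (b - a) / real M"
    and "T > 0" and "N \<ge> 1" and "\<tau> = T / real N"
    and "sftr_cn_solution \<alpha> \<epsilon> M a h N \<tau> u\<^sub>0 U"
    and "1 \<le> n" and "n \<le> N"
  shows "modified_energy_h \<alpha> \<epsilon> M h \<tau> U n \<le> modified_energy_h \<alpha> \<epsilon> M h \<tau> U (n - 1)"
proof -
  let ?I = "{1..int M}" and ?\<theta> = "sftr_theta \<alpha>" and ?V = "cn_V \<epsilon> h U"
  define C where "C = \<tau> powr \<alpha>"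
  have "\<tau> > 0" using assms by simp
  obtain m where n: "n = Suc m" using assms by (cases n) auto
  have per: "periodic_grid M (U n)" "periodic_grid M (U (n - 1))"
    using assms by (auto simp: sftr_cn_solution_def)
  have sol: "U i j k - U 0 j k = C * (\<Sum>s=1..i. ?\<theta> (i - s) * ?V s j k)"
    if "i \<le> N" "j \<in> ?I" "k \<in> ?I" for i j k
    unfolding C_def
    by (rule sftr_inversion[OF assms(1,2) \<open>\<tau> > 0\<close> _ _ that(1)])
      (use assms(10) that in \<open>auto simp: sftr_cn_solution_def cn_V_def\<close>)
  define Q where "Q = (\<lambda>i j k. \<Sum>s=1..i. ?\<theta> (i - s) * (?V s j k)\<^sup>2)"
  \<comment> \<open>At \<open>i = 0\<close> the sum in \<open>Q\<close> is empty, so the formula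
    covers the initial energy and the first step needs no separate case.\<close>
  have modif: "modified_energy_h \<alpha> \<epsilon> M h \<tau> U i
      = energy_h \<epsilon> M h (U i) + h\<^sup>2 * (\<Sum>j\<in>?I. \<Sum>k\<in>?I. C / 2 * Q i j k)" for i
    unfolding modified_energy_h_def sum_grid_norm_squared Q_def C_def
    by (simp add: sum_distrib_left mult_ac)
  have point: "- ?V n j k * (U n j k - U m j k) + (C / 2 * Q n j k - C / 2 * Q m j k) \<le> 0"
    if "j \<in> ?I" "k \<in> ?I" for j k
  proof -
    define D where "D = (\<Sum>s=1..n. ?\<theta> (n - s) * ?V s j k) - (\<Sum>s=1..m. ?\<theta> (m - s) * ?V s j k)"
    \<comment> \<open>Subtracting the inverted scheme at two consecutive levels cancels
      \<open>U 0\<close>. For \<open>m = 0\<close> the second convolution is empty.\<close>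
    have "U n j k - U m j k = C * D"
      using sol[of n j k] sol[of m j k] that assms(12) n by (simp add: D_def right_diff_distrib)
    moreover have "C * (1/2 * (Q n j k - Q m j k)) \<le> C * (?V n j k * D)"
      unfolding Q_def D_def n
      by (intro mult_left_mono sum_antitone_kernel_ge sftr_theta_nonneg sftr_theta_Suc_le assms)
        (simp add: C_def)
    ultimately show ?thesis by (simp add: right_diff_distrib mult.left_commute)
  qed
  have "modified_energy_h \<alpha> \<epsilon> M h \<tau> U n - modified_energy_h \<alpha> \<epsilon> M h \<tau> U m
      \<le> h\<^sup>2 * (\<Sum>j\<in>?I. \<Sum>k\<in>?I. - ?V n j k * (U n j k - U m j k))
        + (h\<^sup>2 * (\<Sum>j\<in>?I. \<Sum>k\<in>?I. C / 2 * Q n j k) - h\<^sup>2 * (\<Sum>j\<in>?I. \<Sum>k\<in>?I. C / 2 * Q m j k))"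
    using energy_h_diff_le[of M U n \<epsilon> h, OF per] unfolding modif by (simp add: n)
  also have "\<dots> = h\<^sup>2 * (\<Sum>j\<in>?I. \<Sum>k\<in>?I. - ?V n j k * (U n j k - U m j k)
      + (C / 2 * Q n j k - C / 2 * Q m j k))"
    by (simp only: distrib_left right_diff_distrib sum.distrib sum_subtractf)
  also have "\<dots> \<le> 0"
    using point by (intro mult_nonneg_nonpos sum_nonpos) auto
  finally show ?thesis by (simp add: n)
qed

end
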